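(* Let $p$ be an odd prime, let $n$ be a positive integer, and let $G$ be a $p$-group of nilpotency class $p+1$. If $G$ is $p^n$-central, then $\exp(\gamma_2(G)) \mid p^n$.
   Context: $\exp(X)$ denotes the exponent of a group $X$. $\gamma_2(G)=[G,G]$ is the commutator subgroup and $Z(G)$ the center of $G$. A group $G$ is called $k$-central if the exponent of $G/Z(G)$ divides $k$. *)

theory Defs
  imports "HOL-Algebra.Algebra"
begin

(* The exponent is 0 when no positive exponent exists; since 0 divides only 0,
   "group_exponent G dvd k" with k > 0 then fails for such a group. *)
definition group_exponent :: "('a, 'b) monoid_scheme \<Rightarrow> nat" where
  "group_exponent G =
    (if \<exists>k::nat. 0 < k \<and> (\<forall>x\<in>carrier G. x [^]\<^bsub>G\<^esub> k = \<one>\<^bsub>G\<^esub>)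
     then LEAST k::nat. 0 < k \<and> (\<forall>x\<in>carrier G. x [^]\<^bsub>G\<^esub> k = \<one>\<^bsub>G\<^esub>)
     else 0)"

definition center :: "('a, 'b) monoid_scheme \<Rightarrow> 'a set" where
  "center G = {z \<in> carrier G. \<forall>x\<in>carrier G. z \<otimes>\<^bsub>G\<^esub> x = x \<otimes>\<^bsub>G\<^esub> z}"

definition k_central :: "nat \<Rightarrow> ('a, 'b) monoid_scheme \<Rightarrow> bool" where
  "k_central k G \<longleftrightarrow> group_exponent (G Mod center G) dvd k"

(* Finiteness is not required. As p is prime, p ^ k is nonzero, so elements of infinite
   order (for which ord is 0) are excluded. *)
definition p_group :: "nat \<Rightarrow> ('a, 'b) monoid_scheme \<Rightarrow> bool" where
  "p_group p G \<longleftrightarrow> Factorial_Ring.prime p \<and> group G \<and> (\<forall>x\<in>carrier G. \<exists>k::nat. group.ord G x = p ^ k)"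

(* Same commutator convention as the library's derived subgroup: [h, k] = h k h^-1 k^-1. *)
definition commutator_subgroup :: "('a, 'b) monoid_scheme \<Rightarrow> 'a set \<Rightarrow> 'a set \<Rightarrow> 'a set" where
  "commutator_subgroup G H K =
    generate G (\<Union>h\<in>H. \<Union>k\<in>K. {h \<otimes>\<^bsub>G\<^esub> k \<otimes>\<^bsub>G\<^esub> inv\<^bsub>G\<^esub> h \<otimes>\<^bsub>G\<^esub> inv\<^bsub>G\<^esub> k})"

(* Indexed from 0: lower_central G i is the usual \<gamma>_(i+1)(G). *)
primrec lower_central :: "('a, 'b) monoid_scheme \<Rightarrow> nat \<Rightarrow> 'a set" where
  "lower_central G 0 = carrier G"
| "lower_central G (Suc i) = commutator_subgroup G (lower_central G i) (carrier G)"

definition nilpotent_group :: "('a, 'b) monoid_scheme \<Rightarrow> bool" where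
  "nilpotent_group G \<longleftrightarrow> group G \<and> (\<exists>c. lower_central G c = {\<one>\<^bsub>G\<^esub>})"

definition nilpotency_class :: "('a, 'b) monoid_scheme \<Rightarrow> nat" where
  "nilpotency_class G = (LEAST c. lower_central G c = {\<one>\<^bsub>G\<^esub>})"

abbreviation gamma2 :: "('a, 'b) monoid_scheme \<Rightarrow> ('a, 'b) monoid_scheme" where
  "gamma2 G \<equiv> G\<lparr>carrier := derived G (carrier G)\<rparr>"

lemma lower_central_1: "lower_central G 1 = carrier (gamma2 G)"
  by (simp add: commutator_subgroup_def derived_def)

lemma (in group) center_normal: "center G \<lhd> G"
proof (rule normal_invI)
  show "subgroup (center G) G"
  proof (rule subgroupI)
    show "inv a \<in> center G" if "a \<in> center G" for a
    proof -
      have a: "a \<in> carrier G" and c: "\<And>x. x \<in> carrier G \<Longrightarrow> a \<otimes> x = x \<otimes> a"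
        using that by (auto simp: center_def)
      have "inv a \<otimes> x = x \<otimes> inv a" if x: "x \<in> carrier G" for x
      proof -
        have "inv (a \<otimes> inv x) = inv (inv x \<otimes> a)" using c[of "inv x"] x by simp
        then show ?thesis using a x by (simp add: inv_mult_group)
      qed
      then show ?thesis using a by (simp add: center_def)
    qed
    show "a \<otimes> b \<in> center G" if "a \<in> center G" "b \<in> center G" for a b
    proof -
      have a: "a \<in> carrier G" and b: "b \<in> carrier G"
        using that by (auto simp: center_def)
      have "a \<otimes> b \<otimes> x = x \<otimes> (a \<otimes> b)" if x: "x \<in> carrier G" for x
      proof -
        have ax: "a \<otimes> x = x \<otimes> a" and bx: "b \<otimes> x = x \<otimes> b"
          using \<open>a \<in> center G\<close> \<open>b \<in> center G\<close> x by (simp_all add: center_def)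
        have "a \<otimes> b \<otimes> x = a \<otimes> (x \<otimes> b)" unfolding bx[symmetric] using a b x by (rule m_assoc)
        also have "\<dots> = x \<otimes> a \<otimes> b"
          unfolding ax[symmetric] using m_assoc[OF a x b] by (rule sym)
        also have "\<dots> = x \<otimes> (a \<otimes> b)" using x a b by (rule m_assoc)
        finally show ?thesis .
      qed
      then show ?thesis using a b by (simp add: center_def)
    qed
  qed (auto simp: center_def)
  show "x \<otimes> h \<otimes> inv x \<in> center G" if "x \<in> carrier G" "h \<in> center G" for x h
  proof -
    have h: "h \<in> carrier G" and hx: "h \<otimes> x = x \<otimes> h" using that by (auto simp: center_def)
    have "x \<otimes> h \<otimes> inv x = h"
      unfolding hx[symmetric] using m_assoc[OF h] that(1) h by simp
    then show ?thesis using that by simp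
  qed
qed

lemma (in group) group_exponent_dvd_iff:
  assumes "0 < m"
  shows "group_exponent G dvd m \<longleftrightarrow> (\<forall>x\<in>carrier G. x [^] m = \<one>)"
proof
  let ?P = "\<lambda>k::nat. 0 < k \<and> (\<forall>x\<in>carrier G. x [^] k = \<one>)"
  have L: "?P (group_exponent G)" if "?P k" for k
  proof -
    have "\<exists>k. ?P k" using that by blast
    then have "group_exponent G = (LEAST k. ?P k)" unfolding group_exponent_def by (rule if_P)
    then show ?thesis using LeastI[of ?P k, OF that] by simp
  qed
  {
    assume d: "group_exponent G dvd m"
    with assms have "group_exponent G \<noteq> 0" by auto
    then have "\<exists>k. ?P k" by (auto simp: group_exponent_def split: if_splits)
    then have "?P (group_exponent G)" using L by blast
    with d show "\<forall>x\<in>carrier G. x [^] m = \<one>"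
      by (auto simp: dvd_def nat_pow_pow[symmetric])
  next
    assume m: "\<forall>x\<in>carrier G. x [^] m = \<one>"
    let ?e = "group_exponent G"
    have e: "?P ?e" using L[of m] assms m by blast
    have "x [^] (m mod ?e) = \<one>" if x: "x \<in> carrier G" for x
    proof -
      have "x [^] m = x [^] (?e * (m div ?e)) \<otimes> x [^] (m mod ?e)"
        using x by (simp add: nat_pow_mult)
      moreover have "x [^] (?e * (m div ?e)) = \<one>"
        using e x by (simp add: nat_pow_pow[symmetric])
      ultimately show ?thesis using m x by simp
    qed
    moreover have "?e \<le> k" if "?P k" for k
    proof -
      have "\<exists>k. ?P k" using that by blast
      then have "?e = (LEAST k. ?P k)" unfolding group_exponent_def by (rule if_P)
      then show ?thesis using Least_le[of ?P k, OF that] by simp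
    qed
    ultimately have "m mod ?e = 0"
      using e mod_less_divisor[of ?e m] by (meson not_gr_zero not_le)
    then show "?e dvd m" by auto
  }
qed

end

theory Submission
  imports Defs
begin

text \<open>
  Put $q = p^n$ and $[a, b] = a^{-1} b^{-1} a b$. The proof shows $\gamma_i(G)^q = 1$ by downward
  induction on $i \ge 2$. For $y \in \gamma_{i-1}(G)$ the sequence $g(m) = [y, x^m]$ is polynomial
  in the sense of Lazard and Leibman, hence a product of factors $a_k^{\binom{m}{k}}$ with
  $a_k \in \gamma_{i-1+k}(G)$. At $m = q$ we have $g(q) = 1$ because $x^q$ is central; the factors with
  $2 \le k < p$ vanish by the induction hypothesis because $q \mid \binom{q}{k}$, and those with
  $k > p$ by nilpotency. What remains is
  $[y, x]^{-q} = [y, x, \ldots, x]^{\binom{q}{p}}$ with $p$ entries $x$. The same expansion shows that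
  the $q$-th power map is multiplicative on $\gamma_i(G)$, so it suffices that the right-hand side is
  trivial. For $i > 2$ it is so by nilpotency. For $i = 2$, replacing $x$ by $x y^j$ only conjugates
  the left-hand side, so the central element $[y, x y^j, \ldots, x y^j]^{\binom{q}{p}}$ does not
  depend on $j$. It is also polynomial in $j$ of degree $p - 1$, and its $(p-1)$-st difference is the
  $(p-1)!$-th power of $[x, y, \ldots, y]^{-\binom{q}{p}}$. As $(p-1)!$ is prime to $p$, the element
  $[x, y, \ldots, y]^{\binom{q}{p}}$ is trivial for all $x$ and $y$.
\<close>

declare lower_central.simps(2) [simp del]

section \<open>Commutators and the lower central series\<close>

context group
begin

lemma inv_mult_cancel: "\<lbrakk>a \<in> carrier G; b \<in> carrier G\<rbrakk> \<Longrightarrow> inv a \<otimes> (a \<otimes> b) = b"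
  by (simp add: m_assoc[symmetric])

lemma mult_inv_cancel: "\<lbrakk>a \<in> carrier G; b \<in> carrier G\<rbrakk> \<Longrightarrow> a \<otimes> (inv a \<otimes> b) = b"
  by (simp add: m_assoc[symmetric])

lemmas word_simps = m_assoc inv_mult_group inv_mult_cancel mult_inv_cancel

text \<open>Both entries are inverted relative to the generators of
  \<open>commutator_subgroup\<close>: h k h^-1 k^-1 is \<open>commutator (inv h) (inv k)\<close>. In
  this form the commutator is the right-hand factor by which conjugation changes a, in step with
  \<open>diff\<close> below.\<close>

definition commutator :: "'a \<Rightarrow> 'a \<Rightarrow> 'a" where
  "commutator a b = inv a \<otimes> inv b \<otimes> a \<otimes> b"

lemma commutator_closed [simp]:
  "\<lbrakk>a \<in> carrier G; b \<in> carrier G\<rbrakk> \<Longrightarrow> commutator a b \<in> carrier G"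
  by (simp add: commutator_def)

lemma inv_commutator:
  "\<lbrakk>a \<in> carrier G; b \<in> carrier G\<rbrakk> \<Longrightarrow> inv (commutator a b) = commutator b a"
  by (simp add: commutator_def word_simps)

lemma conj_eq_mult_commutator:
  "\<lbrakk>a \<in> carrier G; b \<in> carrier G\<rbrakk> \<Longrightarrow> inv b \<otimes> a \<otimes> b = a \<otimes> commutator a b"
  by (simp add: commutator_def word_simps)

lemma commutator_mult_left:
  "\<lbrakk>a \<in> carrier G; b \<in> carrier G; c \<in> carrier G\<rbrakk> \<Longrightarrow>
    commutator (a \<otimes> b) c = commutator a c \<otimes> commutator (commutator a c) b \<otimes> commutator b c"
  by (simp add: commutator_def word_simps)

lemma commutator_mult_right:
  "\<lbrakk>a \<in> carrier G; b \<in> carrier G; c \<in> carrier G\<rbrakk> \<Longrightarrow>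
    commutator a (b \<otimes> c) = commutator a c \<otimes> commutator a b \<otimes> commutator (commutator a b) c"
  by (simp add: commutator_def word_simps)

lemma commutator_mult_right_conj:
  "\<lbrakk>a \<in> carrier G; b \<in> carrier G; c \<in> carrier G\<rbrakk> \<Longrightarrow>
    commutator a (b \<otimes> c) = commutator a c \<otimes> (inv c \<otimes> commutator a b \<otimes> c)"
  by (simp add: commutator_def word_simps)

lemma commutator_inv_right_conj:
  "\<lbrakk>a \<in> carrier G; b \<in> carrier G\<rbrakk> \<Longrightarrow>
    commutator a (inv b) = b \<otimes> inv (commutator a b) \<otimes> inv b"
  by (simp add: commutator_def word_simps)

text \<open>The Hall-Witt identity solved for one of its three factors, so that a normal subgroup
  containing the other two double commutators contains this one.\<close>

lemma Hall_Witt: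
  "\<lbrakk>a \<in> carrier G; b \<in> carrier G; c \<in> carrier G\<rbrakk> \<Longrightarrow>
    commutator (commutator b (inv c)) a =
      c \<otimes> (inv b \<otimes> inv (commutator (commutator a (inv b)) c) \<otimes> b
        \<otimes> (inv a \<otimes> inv (commutator (commutator c (inv a)) b) \<otimes> a)) \<otimes> inv c"
  by (simp add: commutator_def word_simps)

lemma normal_conj:
  assumes "N \<lhd> G" "x \<in> N" "g \<in> carrier G"
  shows "g \<otimes> x \<otimes> inv g \<in> N" "inv g \<otimes> x \<otimes> g \<in> N"
  using normal.inv_op_closed1[OF assms(1,3,2)] normal.inv_op_closed2[OF assms(1,3,2)] by auto

lemma commutator_in_normal:
  assumes "N \<lhd> G" "x \<in> N" "g \<in> carrier G"
  shows "commutator x g \<in> N" "commutator g x \<in> N"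
proof -
  interpret N: normal N G by fact
  have x: "x \<in> carrier G" using assms(2) by simp
  have "inv x \<otimes> (inv g \<otimes> x \<otimes> g) \<in> N"
    using normal_conj[OF assms] assms(2) by simp
  then show *: "commutator x g \<in> N"
    using x assms(3) by (simp add: commutator_def m_assoc)
  then have "inv (commutator x g) \<in> N" by simp
  then show "commutator g x \<in> N" using x assms(3) by (simp add: inv_commutator)
qed

section \<open>Normality, induction and commutators in the lower central series\<close>

lemma lower_central_normal: "lower_central G i \<lhd> G"
proof (induction i)
  case 0
  show ?case by (simp add: normal_inv_iff subgroup_self)
next
  case (Suc i)
  interpret N: normal "lower_central G i" G by fact
  show ?case unfolding lower_central.simps(2) commutator_subgroup_def
  proof (rule normal_generateI)
    show "(\<Union>h\<in>lower_central G i. \<Union>k\<in>carrier G. {h \<otimes> k \<otimes> inv h \<otimes> inv k}) \<subseteq> carrier G"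
      by auto
  next
    fix x g
    assume "x \<in> (\<Union>h\<in>lower_central G i. \<Union>k\<in>carrier G. {h \<otimes> k \<otimes> inv h \<otimes> inv k})"
      and g: "g \<in> carrier G"
    then obtain h k where h: "h \<in> lower_central G i" and k: "k \<in> carrier G"
      and x: "x = h \<otimes> k \<otimes> inv h \<otimes> inv k" by auto
    have "g \<otimes> x \<otimes> inv g = (g \<otimes> h \<otimes> inv g) \<otimes> (g \<otimes> k \<otimes> inv g)
        \<otimes> inv (g \<otimes> h \<otimes> inv g) \<otimes> inv (g \<otimes> k \<otimes> inv g)"
      using N.mem_carrier[OF h] k g by (simp add: x word_simps)
    moreover have "g \<otimes> h \<otimes> inv g \<in> lower_central G i" using normal_conj[OF Suc h g] by simp
    moreover have "g \<otimes> k \<otimes> inv g \<in> carrier G" using g k by simp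
    ultimately show "g \<otimes> x \<otimes> inv g
        \<in> (\<Union>h\<in>lower_central G i. \<Union>k\<in>carrier G. {h \<otimes> k \<otimes> inv h \<otimes> inv k})"
      by blast
  qed
qed

lemma lower_central_subgroup: "subgroup (lower_central G i) G"
  using lower_central_normal by (rule normal_imp_subgroup)

text \<open>Inverting h and k, which stay in the same subgroups, brings the generators into the form
  of \<open>commutator\<close>. Inverses get a case of their own because \<open>generate\<close>
  admits inverses of generators.\<close>

lemma lower_central_Suc_induct [consumes 1, case_names one commutator inv mult]:
  assumes "x \<in> lower_central G (Suc i)"
    and one: "P \<one>"
    and comm: "\<And>h k. \<lbrakk>h \<in> lower_central G i; k \<in> carrier G\<rbrakk> \<Longrightarrow> P (commutator h k)"
    and inv: "\<And>a. \<lbrakk>a \<in> lower_central G (Suc i); P a\<rbrakk> \<Longrightarrow> P (inv a)"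
    and mult: "\<And>a b. \<lbrakk>a \<in> lower_central G (Suc i); b \<in> lower_central G (Suc i); P a; P b\<rbrakk>
      \<Longrightarrow> P (a \<otimes> b)"
  shows "P x"
proof -
  interpret N: normal "lower_central G i" G by (rule lower_central_normal)
  have gen: "P y" if "y \<in> (\<Union>h\<in>lower_central G i. \<Union>k\<in>carrier G. {h \<otimes> k \<otimes> inv h \<otimes> inv k})" for y
  proof -
    obtain h k where h: "h \<in> lower_central G i" and k: "k \<in> carrier G"
      and y: "y = h \<otimes> k \<otimes> inv h \<otimes> inv k" using \<open>y \<in> _\<close> by auto
    have "y = commutator (inv h) (inv k)"
      using N.mem_carrier[OF h] k by (simp add: y commutator_def)
    then show ?thesis using comm[of "inv h" "inv k"] h k by simp
  qed
  have sub: "y \<in> lower_central G (Suc i)"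
    if "y \<in> (\<Union>h\<in>lower_central G i. \<Union>k\<in>carrier G. {h \<otimes> k \<otimes> inv h \<otimes> inv k})" for y
    using that unfolding lower_central.simps(2) commutator_subgroup_def by (rule generate.incl)
  show ?thesis
    using assms(1) unfolding lower_central.simps(2) commutator_subgroup_def
  proof (induction rule: generate.induct)
    case one
    then show ?case using assms(2) by simp
  next
    case (incl h)
    then show ?case by (rule gen)
  next
    case (inv h)
    then show ?case using assms(4) gen sub by blast
  next
    case (eng h1 h2)
    then show ?case
      using mult unfolding lower_central.simps(2) commutator_subgroup_def by blast
  qed
qed

lemma commutator_lower_central_Suc:
  assumes "a \<in> lower_central G i" "g \<in> carrier G"
  shows "commutator a g \<in> lower_central G (Suc i)"
proof -
  interpret N: normal "lower_central G i" G by (rule lower_central_normal)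
  have "commutator a g = inv a \<otimes> inv g \<otimes> inv (inv a) \<otimes> inv (inv g)"
    using assms by (simp add: commutator_def)
  moreover have "inv a \<in> lower_central G i" "inv g \<in> carrier G" using assms by auto
  ultimately show ?thesis
    unfolding lower_central.simps(2) commutator_subgroup_def by (intro generate.incl) blast
qed

text \<open>A three subgroups argument by induction on j with i arbitrary: for a generator [h, k] in
  the second entry, \<open>Hall_Witt\<close> reduces to [[a, h^-1], k^-1] and [[k^-1, a^-1], h]. The
  \<open>Suc\<close> reflects the indexing from 0.\<close>

lemma commutator_lower_central:
  assumes "a \<in> lower_central G i" "b \<in> lower_central G j"
  shows "commutator a b \<in> lower_central G (Suc (i + j))"
  using assms
proof (induction j arbitrary: i a b)
  case 0
  then show ?case using commutator_lower_central_Suc by simp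
next
  case (Suc j)
  let ?N = "lower_central G (Suc (i + Suc j))"
  have nc: "g \<otimes> x \<otimes> inv g \<in> ?N" "inv g \<otimes> x \<otimes> g \<in> ?N" if "x \<in> ?N" "g \<in> carrier G" for x g
    using normal_conj[OF lower_central_normal that] by auto
  note N_one = subgroup.one_closed[OF lower_central_subgroup]
    and N_mult = subgroup.m_closed[OF lower_central_subgroup]
    and N_inv = subgroup.m_inv_closed[OF lower_central_subgroup]
    and N_carrier = subgroup.mem_carrier[OF lower_central_subgroup]
  have a: "a \<in> carrier G" using Suc.prems(1) by (rule N_carrier)
  from Suc.prems(2) show ?case
  proof (induction rule: lower_central_Suc_induct)
    case one
    then show ?case using a N_one by (simp add: commutator_def)
  next
    case (commutator h k)
    have h: "h \<in> carrier G" using commutator(1) by (rule N_carrier)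
    have k: "k \<in> carrier G" by fact
    have h': "inv h \<in> lower_central G j" using commutator(1) by (rule N_inv)
    have a': "inv a \<in> lower_central G i" using Suc.prems(1) by (rule N_inv)
    have "commutator a (inv h) \<in> lower_central G (Suc (i + j))"
      using Suc.prems(1) h' by (rule Suc.IH)
    from commutator_lower_central_Suc[OF this, of "inv k"] k
    have 1: "commutator (commutator a (inv h)) (inv k) \<in> ?N" by simp
    \<comment> \<open>Inversion swaps the entries, so that the induction hypothesis applies with
      \<open>Suc i\<close> to [k^-1, a^-1] and h.\<close>
    have "inv (commutator (inv a) (inv k)) \<in> lower_central G (Suc i)"
      using commutator_lower_central_Suc[OF a', of "inv k"] k by (intro N_inv) simp
    then have "commutator (inv k) (inv a) \<in> lower_central G (Suc i)"
      using k a by (simp add: inv_commutator)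
    from Suc.IH[OF this commutator(1)]
    have 2: "commutator (commutator (inv k) (inv a)) h \<in> ?N" by simp
    have "commutator (commutator h k) a \<in> ?N"
      using Hall_Witt[OF a h inv_closed[OF k]] k
        nc(1)[OF N_mult[OF nc(2)[OF N_inv[OF 1] h] nc(2)[OF N_inv[OF 2] a]], of "inv k"]
      by simp
    then have "inv (commutator (commutator h k) a) \<in> ?N" by (rule N_inv)
    then show ?case using a h k by (simp add: inv_commutator)
  next
    case (inv b)
    have b: "b \<in> carrier G" using inv(1) by (rule N_carrier)
    show ?case unfolding commutator_inv_right_conj[OF a b] by (rule nc(1)[OF N_inv[OF inv(2)] b])
  next
    case (mult b c)
    have b: "b \<in> carrier G" and c: "c \<in> carrier G" using mult(1,2) by (auto intro: N_carrier)
    show ?case unfolding commutator_mult_right_conj[OF a b c]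
      by (rule N_mult[OF mult(4) nc(2)[OF mult(3) c]])
  qed
qed

lemma lower_central_Suc_subset: "lower_central G (Suc i) \<subseteq> lower_central G i"
proof
  fix x assume "x \<in> lower_central G (Suc i)"
  then show "x \<in> lower_central G i"
  proof (induction rule: lower_central_Suc_induct)
    case (commutator h k)
    then show ?case using commutator_in_normal lower_central_normal by blast
  qed (auto intro: lower_central_subgroup subgroup.one_closed subgroup.m_inv_closed subgroup.m_closed)
qed

end

section \<open>Polynomial sequences in filtered groups\<close>

context group begin

text \<open>A discrete derivative acting on the right. Its iterates at 0 play the role of Taylor
  coefficients.\<close>

definition diff :: "(nat \<Rightarrow> 'a) \<Rightarrow> nat \<Rightarrow> 'a" where
  "diff g n = inv (g n) \<otimes> g (Suc n)"

lemma diff_funpow_closed: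
  "(\<And>n. g n \<in> carrier G) \<Longrightarrow> (diff ^^ r) g n \<in> carrier G"
  by (induction r arbitrary: n) (simp_all add: diff_def)

lemma diff_const [simp]: "a \<in> carrier G \<Longrightarrow> diff (\<lambda>n. a) = (\<lambda>n. \<one>)"
  by (simp add: diff_def fun_eq_iff)

lemma diff_funpow_Suc: "(diff ^^ Suc r) g = (diff ^^ r) (diff g)"
  by (simp only: funpow_Suc_right o_def)

lemma diff_funpow_one [simp]: "(diff ^^ r) (\<lambda>n. \<one>) = (\<lambda>n. \<one>)"
  by (induction r) simp_all

text \<open>Each difference shortens the run of leading ones by one and keeps the first value after
  it, since that value is only divided by the neutral element.\<close>

lemma diff_funpow_at_0:
  assumes "\<And>n. g n \<in> carrier G" "\<And>j. j < k \<Longrightarrow> g j = \<one>"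
  shows "(diff ^^ k) g 0 = g k"
  using assms
proof (induction k arbitrary: g)
  case (Suc k)
  have "(diff ^^ k) (diff g) 0 = diff g k"
    using Suc.prems by (intro Suc.IH) (simp_all add: diff_def)
  also have "\<dots> = g (Suc k)" using Suc.prems by (simp add: diff_def)
  finally show ?case by (simp only: diff_funpow_Suc)
qed simp

text \<open>\<open>diff g\<close> inherits the hypotheses with k lowered by one, so it is trivial,
  and g is constant with value g 0.\<close>

lemma eq_one_if_diff_funpow_eq_one:
  assumes "\<And>n. g n \<in> carrier G" "\<And>j. j < k \<Longrightarrow> g j = \<one>" "\<And>n. (diff ^^ k) g n = \<one>"
  shows "g n = \<one>"
  using assms
proof (induction k arbitrary: g n)
  case (Suc k)
  have *: "(diff ^^ k) (diff g) n = \<one>" for n using Suc.prems(3) by (simp only: diff_funpow_Suc)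
  have c: "diff g n \<in> carrier G" for n using Suc.prems(1) by (simp add: diff_def)
  have o: "diff g j = \<one>" if "j < k" for j using Suc.prems(2) that by (simp add: diff_def)
  have d: "diff g m = \<one>" for m by (rule Suc.IH[OF c o *])
  show ?case
  proof (induction n)
    case 0
    then show ?case using Suc.prems(2) by simp
  next
    case (Suc n)
    have "g (Suc n) = g n \<otimes> diff g n" using \<open>\<And>n. g n \<in> carrier G\<close> by (simp add: diff_def word_simps)
    then show ?case using d[of n] Suc.IH by simp
  qed
qed simp

text \<open>Pascal's rule. All values are powers of one element, so no commutators appear; these
  sequences serve as Taylor monomials.\<close>

lemma diff_funpow_binomial:
  assumes "a \<in> carrier G"
  shows "(diff ^^ r) (\<lambda>n. a [^] (n choose k)) =
    (if r \<le> k then \<lambda>n. a [^] (n choose (k - r)) else (\<lambda>n. \<one>))"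
proof -
  have step: "diff (\<lambda>n. a [^] (n choose Suc k)) = (\<lambda>n. a [^] (n choose k))" for k
  proof
    fix n
    have "a [^] (Suc n choose Suc k) = a [^] (n choose Suc k) \<otimes> a [^] (n choose k)"
      using assms by (simp add: nat_pow_mult add.commute)
    then show "diff (\<lambda>n. a [^] (n choose Suc k)) n = a [^] (n choose k)"
      using assms by (simp add: diff_def word_simps)
  qed
  show ?thesis
  proof (induction r arbitrary: k)
    case (Suc r)
    show ?case
    proof (cases k)
      case 0
      then show ?thesis using assms by (simp add: diff_funpow_Suc del: funpow.simps(2))
    next
      case (Suc k')
      then show ?thesis using Suc.IH[of k'] step by (simp add: diff_funpow_Suc del: funpow.simps(2))
    qed
  qed simp
qed

end

text \<open>\<open>F_one\<close> and \<open>F_Suc\<close> force \<open>F 0\<close> to be the whole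
  group too. Degree 0 thus accommodates sequences of powers of an arbitrary element, whose
  differences lie in \<open>F 1\<close>.\<close>

locale group_filtration = group +
  fixes F :: "nat \<Rightarrow> 'a set"
  assumes F_normal: "F i \<lhd> G"
    and F_one: "F (Suc 0) = carrier G"
    and F_Suc: "F (Suc i) \<subseteq> F i"
    and F_commutator: "\<lbrakk>a \<in> F i; b \<in> F j\<rbrakk> \<Longrightarrow> commutator a b \<in> F (i + j)"
begin

lemma F_subgroup: "subgroup (F i) G"
  using F_normal by (rule normal_imp_subgroup)

lemmas F_carrier = subgroup.mem_carrier[OF F_subgroup]
  and F_1 = subgroup.one_closed[OF F_subgroup]
  and F_mult = subgroup.m_closed[OF F_subgroup]
  and F_inv = subgroup.m_inv_closed[OF F_subgroup]

lemma F_pow: "a \<in> F i \<Longrightarrow> a [^] (n::nat) \<in> F i"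
  by (induction n) (simp_all add: F_1 F_mult)

lemma F_antimono: "i \<le> j \<Longrightarrow> F j \<subseteq> F i"
  by (rule lift_Suc_antimono_le) (rule F_Suc)

text \<open>
  Constraining the differences of the pointwise inverse as well makes the notion invariant under
  inversion by definition; closure under products and commutators is then a simultaneous induction
  on the depth.
\<close>
primrec poly_upto :: "nat \<Rightarrow> nat \<Rightarrow> (nat \<Rightarrow> 'a) \<Rightarrow> bool" where
  "poly_upto 0 i g \<longleftrightarrow> (\<forall>n. g n \<in> F i)"
| "poly_upto (Suc k) i g \<longleftrightarrow> (\<forall>n. g n \<in> F i) \<and> poly_upto k (Suc i) (diff g)
    \<and> poly_upto k (Suc i) (diff (\<lambda>n. inv (g n)))"

lemma poly_upto_val: "poly_upto k i g \<Longrightarrow> g n \<in> F i"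
  by (cases k) simp_all

lemma poly_upto_carrier: "poly_upto k i g \<Longrightarrow> g n \<in> carrier G"
  using poly_upto_val F_carrier by blast

lemma poly_upto_SucD: "poly_upto (Suc k) i g \<Longrightarrow> poly_upto k i g"
proof (induction k arbitrary: i g)
  case (Suc k)
  from Suc.prems have "poly_upto (Suc k) (Suc i) (diff g)"
    "poly_upto (Suc k) (Suc i) (diff (\<lambda>n. inv (g n)))"
    unfolding poly_upto.simps(2)[of "Suc k"] by auto
  from this[THEN Suc.IH] show ?case using poly_upto_val[OF Suc.prems] by simp
qed simp

lemma poly_upto_mono: "\<lbrakk>poly_upto k j g; i \<le> j\<rbrakk> \<Longrightarrow> poly_upto k i g"
proof (induction k arbitrary: i j g)
  case 0
  then show ?case using F_antimono by auto
next
  case (Suc k)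
  have "poly_upto k (Suc j) (diff g)" "poly_upto k (Suc j) (diff (\<lambda>n. inv (g n)))"
    using Suc.prems(1) by auto
  from this[THEN Suc.IH, of "Suc i"] show ?case
    using Suc.prems(2) F_antimono[OF Suc.prems(2)] poly_upto_val[OF Suc.prems(1)] by auto
qed

lemma poly_upto_inv: "poly_upto k i g \<Longrightarrow> poly_upto k i (\<lambda>n. inv (g n))"
  using poly_upto_carrier[of k i g] by (cases k) (auto simp: F_inv)

text \<open>The depth-wise form of the theorem that polynomial sequences form a group. Products and
  commutators need each other: the difference of a product contains a conjugate of
  \<open>diff g\<close>, and conjugating means multiplying by a commutator, which is available at
  the smaller depth.\<close>

lemma poly_upto_closed:
  "(\<forall>i g h. poly_upto k i g \<longrightarrow> poly_upto k i h \<longrightarrow> poly_upto k i (\<lambda>n. g n \<otimes> h n)) \<and>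
   (\<forall>i j g h. poly_upto k i g \<longrightarrow> poly_upto k j h \<longrightarrow>
      poly_upto k (i + j) (\<lambda>n. commutator (g n) (h n)))"
proof (induction k)
  case 0
  then show ?case by (simp add: F_mult F_commutator)
next
  case (Suc k)
  have mult: "poly_upto k i (\<lambda>n. g n \<otimes> h n)" if "poly_upto k i g" "poly_upto k i h" for i g h
    using Suc that by blast
  have comm: "poly_upto k m (\<lambda>n. commutator (g n) (h n))"
    if "poly_upto k i g" "poly_upto k j h" "m \<le> i + j" for i j m g h
    using Suc that poly_upto_mono by blast
  have conj: "poly_upto k m (\<lambda>n. h n \<otimes> g n \<otimes> inv (h n))"
    if g: "poly_upto k m g" and h: "poly_upto k i h" for i m g h
  proof -
    have "(\<lambda>n. h n \<otimes> g n \<otimes> inv (h n)) = (\<lambda>n. g n \<otimes> commutator (g n) (inv (h n)))"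
      using poly_upto_carrier[OF g] poly_upto_carrier[OF h]
      by (simp add: commutator_def word_simps)
    then show ?thesis using mult[OF g comm[OF g poly_upto_inv[OF h]]] by simp
  qed
  have diff_mult: "poly_upto k (Suc i) (diff (\<lambda>n. g n \<otimes> h n))"
    if g: "poly_upto (Suc k) i g" and h: "poly_upto (Suc k) i h" for i g h
  proof -
    have c: "g n \<in> carrier G" "h n \<in> carrier G" for n
      using poly_upto_carrier[OF g] poly_upto_carrier[OF h] by auto
    have "diff (\<lambda>n. g n \<otimes> h n) = (\<lambda>n. (inv (h n) \<otimes> diff g n \<otimes> inv (inv (h n))) \<otimes> diff h n)"
      using c by (simp add: diff_def fun_eq_iff word_simps)
    moreover have "poly_upto k (Suc i) \<dots>"
      using g h by (auto intro!: mult conj[of _ _ i] poly_upto_inv poly_upto_SucD[OF h])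
    ultimately show ?thesis by simp
  qed
  \<comment> \<open>With inverted entries the commutator is l = g h g^-1 h^-1. Substituting g (n+1)
    = g n diff g n, and likewise for h, gives l (n+1) = X l(n) Y. Every commutator in X and Y has a
    difference as an entry, which raises the degree by at least one. Applying this to the inverses
    of g and h removes the inversions again.\<close>
  have diff_comm: "poly_upto k (Suc (i + j)) (diff (\<lambda>n. commutator (inv (g n)) (inv (h n))))"
    if g: "poly_upto (Suc k) i g" and h: "poly_upto (Suc k) j h" for i j g h
  proof -
    let ?l = "\<lambda>n. commutator (inv (g n)) (inv (h n))"
    let ?X = "\<lambda>n. g n \<otimes> (commutator (inv (diff g n)) (inv (h n))
      \<otimes> (h n \<otimes> commutator (inv (diff g n)) (inv (diff h n)) \<otimes> inv (h n))) \<otimes> inv (g n)"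
    let ?Y = "\<lambda>n. h n \<otimes> commutator (inv (g n)) (inv (diff h n)) \<otimes> inv (h n)"
    have c: "g n \<in> carrier G" "h n \<in> carrier G" for n
      using poly_upto_carrier[OF g] poly_upto_carrier[OF h] by auto
    note g' = poly_upto_SucD[OF g] and h' = poly_upto_SucD[OF h]
    have dg: "poly_upto k (Suc i) (diff g)" and dh: "poly_upto k (Suc j) (diff h)"
      using g h by auto
    note inv' = poly_upto_inv[OF g'] poly_upto_inv[OF h'] poly_upto_inv[OF dg] poly_upto_inv[OF dh]
    have X: "poly_upto k (Suc (i + j)) ?X"
      by (rule conj[OF mult[OF comm[OF inv'(3,2)] conj[OF comm[OF inv'(3,4)] h']] g']) simp_all
    have Y: "poly_upto k (Suc (i + j)) ?Y"
      by (rule conj[OF comm[OF inv'(1,4)] h']) simp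
    have l: "poly_upto k (i + j) ?l" by (rule comm[OF inv'(1,2)]) simp
    have "diff ?l = (\<lambda>n. (inv (?l n) \<otimes> ?X n \<otimes> inv (inv (?l n))) \<otimes> ?Y n)"
      using c by (simp add: diff_def commutator_def fun_eq_iff word_simps)
    then show ?thesis using mult[OF conj[OF X poly_upto_inv[OF l]] Y] by simp
  qed
  show ?case
  proof (intro conjI allI impI)
    fix i g h assume g: "poly_upto (Suc k) i g" and h: "poly_upto (Suc k) i h"
    have "(\<lambda>n. inv (g n \<otimes> h n)) = (\<lambda>n. inv (h n) \<otimes> inv (g n))"
      using poly_upto_carrier[OF g] poly_upto_carrier[OF h] by (simp add: inv_mult_group)
    then show "poly_upto (Suc k) i (\<lambda>n. g n \<otimes> h n)"
      using diff_mult[OF g h] diff_mult[OF poly_upto_inv[OF h] poly_upto_inv[OF g]]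
        poly_upto_val[OF g] poly_upto_val[OF h] by (simp add: F_mult)
  next
    fix i j g h assume g: "poly_upto (Suc k) i g" and h: "poly_upto (Suc k) j h"
    have c: "g n \<in> carrier G" "h n \<in> carrier G" for n
      using poly_upto_carrier[OF g] poly_upto_carrier[OF h] by auto
    show "poly_upto (Suc k) (i + j) (\<lambda>n. commutator (g n) (h n))"
      using diff_comm[OF poly_upto_inv[OF g] poly_upto_inv[OF h]]
        diff_comm[OF poly_upto_inv[OF h] poly_upto_inv[OF g]]
        poly_upto_val[OF g] poly_upto_val[OF h] c
      by (simp add: F_commutator inv_commutator add.commute)
  qed
qed

definition poly_seq :: "nat \<Rightarrow> (nat \<Rightarrow> 'a) \<Rightarrow> bool" where
  "poly_seq i g \<longleftrightarrow> (\<forall>k. poly_upto k i g)"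

lemma poly_seq_mult: "\<lbrakk>poly_seq i g; poly_seq i h\<rbrakk> \<Longrightarrow> poly_seq i (\<lambda>n. g n \<otimes> h n)"
  using poly_upto_closed by (simp add: poly_seq_def)

lemma poly_seq_commutator:
  "\<lbrakk>poly_seq i g; poly_seq j h\<rbrakk> \<Longrightarrow> poly_seq (i + j) (\<lambda>n. commutator (g n) (h n))"
  using poly_upto_closed by (simp add: poly_seq_def)

lemma poly_seq_mono: "\<lbrakk>poly_seq j g; i \<le> j\<rbrakk> \<Longrightarrow> poly_seq i g"
  unfolding poly_seq_def using poly_upto_mono by blast

lemma poly_seq_diff: "poly_seq i g \<Longrightarrow> poly_seq (Suc i) (diff g)"
  unfolding poly_seq_def using poly_upto.simps(2) by blast

lemma poly_seq_val: "poly_seq i g \<Longrightarrow> g n \<in> F i"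
  unfolding poly_seq_def using poly_upto_val by blast

lemma poly_seq_carrier: "poly_seq i g \<Longrightarrow> g n \<in> carrier G"
  using poly_seq_val F_carrier by blast

lemma poly_seq_diff_funpow: "poly_seq i g \<Longrightarrow> (diff ^^ r) g n \<in> F (i + r)"
  by (induction r arbitrary: i g) (force simp: diff_funpow_Suc poly_seq_val dest: poly_seq_diff simp del: funpow.simps(2))+

text \<open>A difference lowers k by one and raises the degree by one, so \<open>i + k\<close> is
  preserved; the pointwise inverse is the same sequence for \<open>inv a\<close>.\<close>

lemma poly_seq_binomial:
  assumes "a \<in> F (i + k)"
  shows "poly_seq i (\<lambda>n. a [^] (n choose k))"
proof -
  have a: "a \<in> carrier G" using assms by (rule F_carrier)
  have one: "poly_upto d i (\<lambda>n. \<one>)" for d i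
    by (induction d arbitrary: i) (simp_all add: F_1)
  have "poly_upto d i (\<lambda>n. a [^] (n choose k))" if "a \<in> F (i + k)" for d i k a
    using that
  proof (induction d arbitrary: a i k)
    case 0
    then show ?case using F_antimono[of i "i + k"] F_pow by auto
  next
    case (Suc d)
    have inv: "(\<lambda>n. inv (a [^] (n choose k))) = (\<lambda>n. inv a [^] (n choose k))"
      using F_carrier[OF Suc.prems] by (simp add: nat_pow_inv)
    have dif: "poly_upto d (Suc i) (diff (\<lambda>n. a [^] (n choose k)))" if "a \<in> F (i + k)" for a
    proof (cases k)
      case 0
      then show ?thesis using F_carrier[OF that] by (simp add: one)
    next
      case (Suc k')
      then show ?thesis using Suc.IH[of a "Suc i" k'] that
          diff_funpow_binomial[OF F_carrier[OF that], of 1 k] by simp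
    qed
    show ?case
      using dif[OF Suc.prems] dif[OF F_inv[OF Suc.prems]] inv
        F_antimono[of i "i + k"] F_pow[OF Suc.prems] by auto
  qed
  then show ?thesis using assms by (simp add: poly_seq_def)
qed

lemma poly_seq_const: "a \<in> F i \<Longrightarrow> poly_seq i (\<lambda>n. a)"
  using poly_seq_binomial[of a i 0] F_carrier by simp

lemma poly_seq_power: "a \<in> F (Suc i) \<Longrightarrow> poly_seq i (\<lambda>n. a [^] n)"
  using poly_seq_binomial[of a i 1] by simp

text \<open>The difference of a product is diff g [diff g, h] diff h. As i is positive, the
  commutator has degree at least i + 2, so the remaining differences send it into the trivial term
  of the filtration.\<close>

lemma diff_funpow_mult:
  assumes "poly_seq i g" "poly_seq i h" "1 \<le> i" "F (Suc (i + r)) = {\<one>}"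
  shows "(diff ^^ r) (\<lambda>n. g n \<otimes> h n) = (\<lambda>n. (diff ^^ r) g n \<otimes> (diff ^^ r) h n)"
  using assms
proof (induction r arbitrary: i g h)
  case (Suc r)
  let ?c = "\<lambda>n. commutator (diff g n) (h n)"
  have c: "g n \<in> carrier G" "h n \<in> carrier G" for n
    using Suc.prems(1,2) poly_seq_carrier by auto
  have dg: "poly_seq (Suc i) (diff g)" and dh: "poly_seq (Suc i) (diff h)"
    using Suc.prems poly_seq_diff by auto
  have pc: "poly_seq (Suc (Suc i)) ?c"
    using poly_seq_mono[OF poly_seq_commutator[OF dg Suc.prems(2)]] Suc.prems(3) by simp
  then have pc': "poly_seq (Suc i) ?c" by (rule poly_seq_mono) simp
  have z: "(diff ^^ r) ?c n = \<one>" for n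
    using poly_seq_diff_funpow[OF pc, of r n] Suc.prems(4) by simp
  have F: "F (Suc (Suc i + r)) = {\<one>}" using Suc.prems(4) by simp
  have cl: "(diff ^^ r) (diff g) n \<in> carrier G" for n
    using poly_seq_diff_funpow[OF dg] F_carrier by blast
  have "diff (\<lambda>n. g n \<otimes> h n) = (\<lambda>n. (diff g n \<otimes> ?c n) \<otimes> diff h n)"
    using c by (simp add: diff_def commutator_def fun_eq_iff word_simps)
  then show ?case
    using Suc.IH[OF poly_seq_mult[OF dg pc'] dh _ F] Suc.IH[OF dg pc' _ F] z cl
    by (simp add: diff_funpow_Suc del: funpow.simps(2))
qed simp

end

section \<open>Values of polynomial sequences at prime powers\<close>

text \<open>From k C(q, k) = q C(q-1, k-1) with q = p^n, where k is prime to p.\<close>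

lemma prime_power_dvd_binomial:
  fixes p :: nat
  assumes "Factorial_Ring.prime p" "0 < k" "k < p"
  shows "p ^ n dvd (p ^ n choose k)"
proof -
  have "coprime p k"
    using assms nat_dvd_not_less prime_imp_coprime by blast
  then have "coprime (p ^ n) k" by simp
  moreover have "p ^ n dvd k * (p ^ n choose k)"
    using times_binomial_minus1_eq[OF assms(2), of "p ^ n"] by simp
  ultimately show ?thesis by (simp add: coprime_dvd_mult_right_iff)
qed

context group begin

lemma eq_if_inv_mult_eq_one:
  assumes "x \<in> carrier G" "y \<in> carrier G" "inv x \<otimes> y = \<one>"
  shows "y = x"
  using assms by (metis inv_closed inv_equality inv_inv)

text \<open>The left-normed commutator [a, z, ..., z] with m entries z.\<close>

primrec engel :: "nat \<Rightarrow> 'a \<Rightarrow> 'a \<Rightarrow> 'a" where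
  "engel 0 a z = a"
| "engel (Suc m) a z = engel m (commutator a z) z"

lemma engel_closed [simp]:
  "\<lbrakk>a \<in> carrier G; z \<in> carrier G\<rbrakk> \<Longrightarrow> engel m a z \<in> carrier G"
  by (induction m arbitrary: a) simp_all

lemma conj_pow:
  assumes "a \<in> carrier G" "g \<in> carrier G"
  shows "(inv g \<otimes> a \<otimes> g) [^] (n::nat) = inv g \<otimes> a [^] n \<otimes> g"
  using assms by (induction n) (simp_all add: word_simps)

lemma commutator_mult_power_self:
  assumes "x \<in> carrier G" "y \<in> carrier G"
  shows "commutator y (x \<otimes> y [^] (j::nat)) = inv (y [^] j) \<otimes> commutator y x \<otimes> y [^] j"
proof -
  have "inv y \<otimes> inv (y [^] j) = inv (y [^] j) \<otimes> inv y"
    using assms by (simp add: inv_mult_group[symmetric] nat_pow_Suc2[symmetric])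
  then have "inv y \<otimes> (inv (y [^] j) \<otimes> b) = inv (y [^] j) \<otimes> (inv y \<otimes> b)" if "b \<in> carrier G" for b
    using assms that by (simp add: m_assoc[symmetric])
  then show ?thesis using assms by (simp add: commutator_def word_simps)
qed

lemma diff_conj_power:
  assumes "a \<in> carrier G" "x \<in> carrier G"
  shows "diff (\<lambda>n. inv (x [^] n) \<otimes> a \<otimes> x [^] n)
    = (\<lambda>n. inv (x [^] n) \<otimes> commutator a x \<otimes> x [^] n)"
  using assms
  unfolding diff_def nat_pow_Suc2[OF assms(2)]
  by (simp add: fun_eq_iff commutator_def word_simps)

lemma diff_commutator_power:
  assumes "a \<in> carrier G" "x \<in> carrier G"
  shows "diff (\<lambda>n. commutator a (x [^] n)) = (\<lambda>n. inv (x [^] n) \<otimes> commutator a x \<otimes> x [^] n)"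
  using assms
  unfolding diff_def nat_pow_Suc2[OF assms(2)]
  by (simp add: fun_eq_iff commutator_def word_simps)

text \<open>The first difference of [a, x^n] is [a, x] conjugated by x^n. Each further difference
  replaces the conjugated element by its commutator with x, and at n = 0 the conjugation
  disappears.\<close>

lemma diff_funpow_commutator_power:
  assumes "a \<in> carrier G" "x \<in> carrier G"
  shows "(diff ^^ Suc m) (\<lambda>n. commutator a (x [^] n)) 0 = engel (Suc m) a x"
proof -
  have "(diff ^^ m) (\<lambda>n. inv (x [^] n) \<otimes> a \<otimes> x [^] n) 0 = engel m a x"
    if "a \<in> carrier G" for a
    using that
  proof (induction m arbitrary: a)
    case (Suc m)
    then show ?case using diff_conj_power[OF Suc.prems assms(2)] assms(2)
      by (simp only: diff_funpow_Suc engel.simps commutator_closed)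
  qed (simp add: assms)
  then show ?thesis
    using assms by (simp only: diff_funpow_Suc diff_commutator_power engel.simps commutator_closed)
qed

end

context group_filtration begin

text \<open>
  Divide off the Taylor factors $a_k^{\binom{m}{k}}$ one at a time. Their $q$-th values are trivial for
  $k < p$, and the $p$-th difference, being multiplicative here, is not affected.
\<close>
lemma poly_seq_prime_power_value:
  fixes p n :: nat
  defines "q \<equiv> p ^ n"
  assumes p: "Factorial_Ring.prime p" and i: "1 \<le> i" and F: "F (Suc (i + p)) = {\<one>}"
    and exp: "\<And>a. a \<in> F (i + 2) \<Longrightarrow> a [^] q = \<one>"
    and g: "poly_seq i g" "g 0 = \<one>" "g 1 = \<one>"
  shows "g q = (diff ^^ p) g 0 [^] (q choose p)"
proof -
  have strip: "poly_seq i (\<lambda>n. inv a [^] (n choose k) \<otimes> h n)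
      \<and> (\<forall>j<Suc k. inv a [^] (j choose k) \<otimes> h j = \<one>)"
    if h: "poly_seq i h" "\<forall>j<k. h j = \<one>" and a: "a = h k" for h k a
  proof -
    have c: "h n \<in> carrier G" for n using h(1) by (rule poly_seq_carrier)
    have "a = (diff ^^ k) h 0" using diff_funpow_at_0[of h k] c h(2) a by simp
    then have "a \<in> F (i + k)" using poly_seq_diff_funpow[OF h(1)] by simp
    then have "poly_seq i (\<lambda>n. inv a [^] (n choose k) \<otimes> h n)"
      by (intro poly_seq_mult poly_seq_binomial F_inv h(1))
    moreover have "inv a [^] (j choose k) \<otimes> h j = \<one>" if "j < Suc k" for j
      using that h(2) c by (cases "j = k") (simp_all add: a binomial_eq_0)
    ultimately show ?thesis by blast
  qed
  \<comment> \<open>The range starts at 2 because a factor with k = 1 would only be known to lie in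
    \<open>F (i + 1)\<close>, which \<open>exp\<close> does not cover; \<open>g 0\<close> and
    \<open>g 1\<close> being trivial makes this start possible.\<close>
  have "\<exists>h. poly_seq i h \<and> (\<forall>j<k. h j = \<one>) \<and> h q = g q \<and> (diff ^^ p) h 0 = (diff ^^ p) g 0"
    if "2 \<le> k" "k \<le> p" for k
    using that
  proof (induction k rule: dec_induct)
    case base
    have "\<forall>j<2. g j = \<one>" using g by (simp add: less_2_cases_iff)
    then show ?case using g(1) by blast
  next
    case (step k)
    then obtain h where h: "poly_seq i h" "\<forall>j<k. h j = \<one>" and hq: "h q = g q"
      and hp: "(diff ^^ p) h 0 = (diff ^^ p) g 0" by auto
    define a where "a = h k"
    have c: "h n \<in> carrier G" for n using h(1) by (rule poly_seq_carrier)
    have "a = (diff ^^ k) h 0" using diff_funpow_at_0[of h k] c h(2) a_def by simp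
    then have a: "a \<in> F (i + k)" using poly_seq_diff_funpow[OF h(1)] by simp
    then have a': "inv a \<in> F (i + k)" by (rule F_inv)
    have ac: "inv a \<in> carrier G" using a' by (rule F_carrier)
    obtain d where d: "(q choose k) = q * d"
      using prime_power_dvd_binomial[OF p, of k n] step by (auto simp: q_def elim: dvdE)
    have "inv a \<in> F (i + 2)" using a' F_antimono[of "i + 2" "i + k"] step by auto
    then have "inv a [^] (q choose k) = \<one>"
      using exp ac by (simp add: d nat_pow_pow[symmetric])
    moreover have "(diff ^^ p) (\<lambda>n. inv a [^] (n choose k) \<otimes> h n) 0 = (diff ^^ p) h 0"
      using diff_funpow_mult[OF poly_seq_binomial[OF a'] h(1) i F]
        diff_funpow_binomial[OF ac, of p k] step diff_funpow_closed[of h p 0] c by simp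
    ultimately show ?case
      using strip[OF h a_def] hq hp c[of q] by (intro exI[of _ "\<lambda>n. inv a [^] (n choose k) \<otimes> h n"]) simp
  qed
  from this[of p] prime_ge_2_nat[OF p] obtain h where h: "poly_seq i h" "\<forall>j<p. h j = \<one>"
    and hq: "h q = g q" and hp: "(diff ^^ p) h 0 = (diff ^^ p) g 0" by auto
  have c: "h n \<in> carrier G" for n using h(1) by (rule poly_seq_carrier)
  define h' where "h' = (\<lambda>n. inv (h p) [^] (n choose p) \<otimes> h n)"
  have h': "poly_seq i h'" "\<forall>j<Suc p. h' j = \<one>" using strip[OF h refl] by (auto simp: h'_def)
  \<comment> \<open>Now p + 1 leading values are trivial, and the (p+1)-st difference takes values
    in \<open>F (i + p + 1)\<close>, which is trivial.\<close>
  have "h' q = \<one>"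
  proof (rule eq_one_if_diff_funpow_eq_one[of h' "Suc p"])
    show "(diff ^^ Suc p) h' n = \<one>" for n
      using poly_seq_diff_funpow[OF h'(1), of "Suc p" n] F by simp
  qed (use h' poly_seq_carrier in auto)
  then have "inv (h p [^] (q choose p)) \<otimes> h q = \<one>"
    using c by (simp add: h'_def nat_pow_inv)
  then have "h q = h p [^] (q choose p)"
    by (rule eq_if_inv_mult_eq_one[rotated 2]) (use c in \<open>simp_all\<close>)
  moreover have "h p = (diff ^^ p) h 0" using diff_funpow_at_0[of h p] c h(2) by simp
  ultimately show ?thesis using hq hp by simp
qed

text \<open>Apply the preceding lemma to c^-m [y, x^m] with c = [y, x]; the factor c^-m makes the
  value at 1 trivial. It is linear in m, so it does not contribute to the p-th difference, which is
  the Engel commutator. At m = q only c^-q remains, by \<open>central\<close>.\<close>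

lemma commutator_prime_power:
  fixes p n :: nat
  defines "q \<equiv> p ^ n"
  assumes p: "Factorial_Ring.prime p" and i: "1 \<le> i" and F: "F (Suc (i + p)) = {\<one>}"
    and exp: "\<And>a. a \<in> F (i + 2) \<Longrightarrow> a [^] q = \<one>"
    and y: "y \<in> F i" and x: "x \<in> carrier G" and central: "y \<otimes> x [^] q = x [^] q \<otimes> y"
  shows "inv (commutator y x) [^] q = engel p y x [^] (q choose p)"
proof -
  have yc: "y \<in> carrier G" using y by (rule F_carrier)
  let ?c = "commutator y x"
  let ?g = "\<lambda>n. commutator y (x [^] n)"
  have "?c \<in> F (Suc i)" using F_commutator[OF y, of x 1] x F_one by simp
  then have c': "inv ?c \<in> F (Suc i)" by (rule F_inv)
  then have pc: "poly_seq i (\<lambda>n. inv ?c [^] n)" by (rule poly_seq_power)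
  have pg: "poly_seq i ?g"
    using poly_seq_commutator[OF poly_seq_const[OF y] poly_seq_power[of x 0]] x F_one by simp
  have p2: "2 \<le> p" using p by (rule prime_ge_2_nat)
  then obtain m where m: "p = Suc m" by (cases p) auto
  have "(diff ^^ p) (\<lambda>n. inv ?c [^] n \<otimes> ?g n) 0 = engel p y x"
    using diff_funpow_mult[OF pc pg i F] diff_funpow_binomial[of "inv ?c" p 1] p2 x yc
      diff_funpow_commutator_power[OF yc x, of m]
    by (simp add: m del: funpow.simps engel.simps)
  moreover have "?g q = \<one>"
    using central yc x by (simp add: commutator_def m_assoc inv_mult_cancel)
  ultimately show ?thesis
    using poly_seq_prime_power_value[OF p i F exp[unfolded q_def] poly_seq_mult[OF pc pg]] yc x
    by (simp add: q_def commutator_def)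
qed

text \<open>The sequence b^-m a^-m (ab)^m is trivial at 0 and 1. Its p-th difference is trivial
  since each factor is linear in m, hence so is its value at q.\<close>

lemma mult_prime_power:
  fixes p n :: nat
  defines "q \<equiv> p ^ n"
  assumes p: "Factorial_Ring.prime p" and i: "1 \<le> i" and F: "F (Suc (i + p)) = {\<one>}"
    and exp: "\<And>a. a \<in> F (i + 2) \<Longrightarrow> a [^] q = \<one>"
    and a: "a \<in> F (Suc i)" and b: "b \<in> F (Suc i)"
  shows "(a \<otimes> b) [^] q = a [^] q \<otimes> b [^] q"
proof -
  have c: "a \<in> carrier G" "b \<in> carrier G" using a b F_carrier by auto
  note pow = poly_seq_power[OF F_inv[OF b]] poly_seq_power[OF F_inv[OF a]]
    poly_seq_power[OF F_mult[OF a b]]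
  note pab = poly_seq_mult[OF pow(2,3)]
  have d: "(diff ^^ p) (\<lambda>n. g [^] n) 0 = \<one>" if "g \<in> carrier G" for g
    using diff_funpow_binomial[OF that, of p 1] prime_ge_2_nat[OF p] by simp
  have "(diff ^^ p) (\<lambda>n. inv b [^] n \<otimes> (inv a [^] n \<otimes> (a \<otimes> b) [^] n)) 0 = \<one>"
    using diff_funpow_mult[OF pow(1) pab i F] diff_funpow_mult[OF pow(2,3) i F] d c by simp
  then have "inv b [^] q \<otimes> (inv a [^] q \<otimes> (a \<otimes> b) [^] q) = \<one>"
    using poly_seq_prime_power_value[OF p i F exp[unfolded q_def] poly_seq_mult[OF pow(1) pab]] c
    by (simp add: q_def word_simps)
  then have "inv (a [^] q \<otimes> b [^] q) \<otimes> (a \<otimes> b) [^] q = \<one>"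
    using c by (simp add: nat_pow_inv word_simps)
  then show ?thesis
    by (rule eq_if_inv_mult_eq_one[rotated 2]) (use c in \<open>simp_all\<close>)
qed

end

section \<open>Engel commutators in the last term of the filtration\<close>

context group_filtration begin

lemma F_central:
  assumes "F (Suc s) = {\<one>}" "a \<in> F s" "g \<in> carrier G"
  shows "a \<otimes> g = g \<otimes> a"
proof -
  have "commutator a g \<in> F (s + 1)" using assms(2,3) F_one by (intro F_commutator) simp_all
  then have "commutator a g = \<one>" using assms(1) by simp
  moreover have "a \<in> carrier G" using assms(2) by (rule F_carrier)
  moreover have "a \<otimes> g = g \<otimes> a \<otimes> commutator a g"
    using calculation(2) assms(3) by (simp add: commutator_def word_simps)
  ultimately show ?thesis using assms(3) by simp
qed

lemma engel_F: "\<lbrakk>u \<in> F r; z \<in> carrier G\<rbrakk> \<Longrightarrow> engel m u z \<in> F (r + m)"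
proof (induction m arbitrary: u r)
  case (Suc m)
  have "commutator u z \<in> F (Suc r)" using F_commutator[of u r z 1] Suc.prems F_one by simp
  from Suc.IH[OF this Suc.prems(2)] show ?case by simp
qed simp

lemma engel_eq_one:
  assumes "u \<in> F (Suc r)" "z \<in> carrier G" "F (Suc (r + m)) = {\<one>}"
  shows "engel m u z = \<one>"
  using engel_F[OF assms(1,2), of m] assms(3) by simp

text \<open>The correction term [[u, z], v] in the expansion of [uv, z] has degree at least r + 2,
  so the remaining m commutators with z annihilate it.\<close>

lemma engel_mult:
  assumes "u \<in> F r" "v \<in> F r" "1 \<le> r" "z \<in> carrier G" "F (Suc (r + m)) = {\<one>}"
  shows "engel m (u \<otimes> v) z = engel m u z \<otimes> engel m v z"
  using assms
proof (induction m arbitrary: u v r)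
  case (Suc m)
  let ?w = "commutator (commutator u z) v"
  have c: "u \<in> carrier G" "v \<in> carrier G" using Suc.prems F_carrier by auto
  have u: "commutator u z \<in> F (Suc r)" and v: "commutator v z \<in> F (Suc r)"
    using F_commutator[of _ r z 1] Suc.prems F_one by auto
  have "?w \<in> F (Suc r + r)" using F_commutator[OF u Suc.prems(2)] .
  then have w: "?w \<in> F (Suc (Suc r))" using F_antimono[of "Suc (Suc r)" "Suc r + r"] Suc.prems(3) by auto
  then have w': "?w \<in> F (Suc r)" using F_Suc by auto
  have F: "F (Suc (Suc r + m)) = {\<one>}" using Suc.prems(5) by simp
  have r: "1 \<le> Suc r" by simp
  show ?case
    using Suc.IH[OF F_mult[OF u w'] v r Suc.prems(4) F] Suc.IH[OF u w' r Suc.prems(4) F]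
      engel_eq_one[OF w Suc.prems(4) F] c Suc.prems(4)
    by (simp add: commutator_mult_left)
qed simp

lemma engel_commutator_power:
  assumes "u \<in> F r" "1 \<le> r" "z \<in> carrier G" "y \<in> carrier G" "F (Suc (Suc r + m)) = {\<one>}"
  shows "engel m (commutator u (y [^] (j::nat))) z = engel m (commutator u y) z [^] j"
proof (induction j)
  case 0
  have "engel m \<one> z = \<one>" using engel_eq_one[OF F_1 assms(3,5)] .
  then show ?case using F_carrier[OF assms(1)] by (simp add: commutator_def)
next
  case (Suc j)
  have uc: "u \<in> carrier G" using assms(1) by (rule F_carrier)
  have c: "commutator u x \<in> F (Suc r)" if "x \<in> carrier G" for x
    using F_commutator[of u r x 1] assms F_one that by simp
  have w: "commutator (commutator u (y [^] j)) y \<in> F (Suc (Suc r))"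
    using F_commutator[OF c, of "y [^] j" y 1] assms F_one by simp
  then have w': "commutator (commutator u (y [^] j)) y \<in> F (Suc r)" using F_Suc by auto
  have r: "1 \<le> Suc r" by simp
  have yj: "y [^] j \<in> carrier G" using assms by simp
  have "engel m (commutator u (y [^] j \<otimes> y)) z
      = engel m (commutator u y) z \<otimes> engel m (commutator u (y [^] j)) z"
    using engel_mult[OF F_mult[OF c[OF assms(4)] c[OF yj]] w' r assms(3,5)]
      engel_mult[OF c[OF assms(4)] c[OF yj] r assms(3,5)] engel_eq_one[OF w assms(3,5)] uc assms
    by (simp add: commutator_mult_right)
  then show ?case using Suc.IH uc assms by (simp add: nat_pow_Suc2[symmetric] del: nat_pow_Suc)
qed

section \<open>Differences of sequences in the central last term of the filtration\<close>

context
  fixes s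
  assumes top: "F (Suc s) = {\<one>}"
begin

lemma diff_top: "(\<And>n. f n \<in> F s) \<Longrightarrow> diff f n \<in> F s"
  by (simp add: diff_def F_mult F_inv)

lemma diff_funpow_top: "(\<And>n. f n \<in> F s) \<Longrightarrow> (diff ^^ r) f n \<in> F s"
  by (induction r arbitrary: n) (simp_all add: diff_top)

lemma diff_mult_top:
  assumes "\<And>n. f n \<in> F s" "\<And>n. g n \<in> F s"
  shows "diff (\<lambda>n. f n \<otimes> g n) = (\<lambda>n. diff f n \<otimes> diff g n)"
proof
  fix n
  have c: "f n \<in> carrier G" "g n \<in> carrier G" for n using assms F_carrier by auto
  have "diff (\<lambda>n. f n \<otimes> g n) n = inv (g n) \<otimes> diff f n \<otimes> g (Suc n)"
    using c by (simp add: diff_def word_simps)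
  also have "inv (g n) \<otimes> diff f n = diff f n \<otimes> inv (g n)"
    using F_central[OF top diff_top[of f n], of "inv (g n)"] assms c by simp
  finally show "diff (\<lambda>n. f n \<otimes> g n) n = diff f n \<otimes> diff g n"
    using c by (simp add: diff_def word_simps)
qed

lemma diff_funpow_mult_top:
  assumes "\<And>n. f n \<in> F s" "\<And>n. g n \<in> F s"
  shows "(diff ^^ r) (\<lambda>n. f n \<otimes> g n) = (\<lambda>n. (diff ^^ r) f n \<otimes> (diff ^^ r) g n)"
proof (induction r)
  case (Suc r)
  then show ?case
    using diff_mult_top[of "(diff ^^ r) f" "(diff ^^ r) g"] assms diff_funpow_top by simp
qed simp

lemma diff_funpow_power_top:
  assumes "\<And>n. f n \<in> F s"
  shows "(diff ^^ r) (\<lambda>n. f n [^] (c::nat)) = (\<lambda>n. (diff ^^ r) f n [^] c)"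
proof (induction c)
  case (Suc c)
  then show ?case using diff_funpow_mult_top[of "\<lambda>n. f n [^] c" f r] assms F_pow by simp
qed simp

text \<open>The discrete Leibniz rule for n f(n), written multiplicatively in the abelian group
  \<open>F s\<close>.\<close>

lemma diff_funpow_variable_power_top:
  assumes f: "\<And>n. f n \<in> F s"
  shows "(diff ^^ Suc k) (\<lambda>n. f n [^] n) =
    (\<lambda>n. (diff ^^ k) f (Suc n) [^] Suc k \<otimes> (diff ^^ Suc k) f n [^] n)"
proof -
  have step: "diff (\<lambda>n. h n [^] n) = (\<lambda>n. h (Suc n) \<otimes> diff h n [^] n)"
    if h: "\<And>n. h n \<in> F s" for h
  proof
    fix n
    have c: "h n \<in> carrier G" for n using h F_carrier by auto
    have "diff h n [^] n = inv (h n) [^] n \<otimes> h (Suc n) [^] n"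
      unfolding diff_def
      by (rule pow_mult_distrib) (use c h F_central[OF top F_inv[OF h]] in auto)
    moreover have "inv (h n) [^] n \<otimes> h (Suc n) = h (Suc n) \<otimes> inv (h n) [^] n"
      using F_central[OF top F_pow[OF F_inv[OF h]]] c by simp
    ultimately show "diff (\<lambda>n. h n [^] n) n = h (Suc n) \<otimes> diff h n [^] n"
      using c unfolding diff_def nat_pow_Suc2[OF c]
      by (simp add: nat_pow_inv m_assoc[symmetric])
  qed
  show ?thesis
  proof (induction k)
    case 0
    have "f n \<in> carrier G" for n using f by (rule F_carrier)
    then show ?case using step[of f, OF f] by simp
  next
    case (Suc k)
    let ?h = "(diff ^^ Suc k) f"
    have h: "?h n \<in> F s" and h': "(diff ^^ k) f n \<in> F s" for n
      using f by (rule diff_funpow_top)+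
    have c: "?h n \<in> carrier G" "diff ?h n \<in> carrier G" for n
      using h diff_top[of ?h] F_carrier by auto
    have "(diff ^^ Suc (Suc k)) (\<lambda>n. f n [^] n)
      = diff (\<lambda>n. (diff ^^ k) f (Suc n) [^] Suc k \<otimes> ?h n [^] n)"
      using Suc.IH by (simp only: funpow.simps(2) o_apply)
    also have "\<dots> = (\<lambda>n. diff (\<lambda>n. (diff ^^ k) f (Suc n) [^] Suc k) n \<otimes> diff (\<lambda>n. ?h n [^] n) n)"
      by (rule diff_mult_top) (use h h' F_pow in blast)+
    also have "diff (\<lambda>n. (diff ^^ k) f (Suc n) [^] Suc k) = (\<lambda>n. ?h (Suc n) [^] Suc k)"
    proof -
      have "diff (\<lambda>n. (diff ^^ k) f (Suc n)) = (\<lambda>n. ?h (Suc n))"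
        by (simp add: diff_def fun_eq_iff)
      then show ?thesis
        using diff_funpow_power_top[of "\<lambda>n. (diff ^^ k) f (Suc n)" 1 "Suc k"] h' by simp
    qed
    also have "diff (\<lambda>n. ?h n [^] n) = (\<lambda>n. ?h (Suc n) \<otimes> diff ?h n [^] n)"
      using h by (rule step)
    also have "(\<lambda>n. ?h (Suc n) [^] Suc k \<otimes> (?h (Suc n) \<otimes> diff ?h n [^] n))
        = (\<lambda>n. ?h (Suc n) [^] Suc (Suc k) \<otimes> diff ?h n [^] n)"
      using c by (simp add: m_assoc[symmetric] del: funpow.simps)
    finally show ?case by simp
  qed
qed

text \<open>In j the left side is polynomial of degree m with leading coefficient [u, y, ..., y], up
  to the factor m!. Expanding [u, x y^j] splits off a j-th power; by induction the m-th differences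
  of both remaining factors are constant, and the Leibniz rule supplies the factor m + 1.\<close>

lemma diff_funpow_engel:
  assumes "u \<in> F r" "1 \<le> r" "r + m = s" "x \<in> carrier G" "y \<in> carrier G"
  shows "(diff ^^ m) (\<lambda>j. engel m u (x \<otimes> y [^] j)) = (\<lambda>j. engel m u y [^] (fact m :: nat))"
  using assms
proof (induction m arbitrary: u r)
  case 0
  then show ?case using F_carrier by auto
next
  case (Suc m)
  let ?z = "\<lambda>j::nat. x \<otimes> y [^] j"
  let ?f = "\<lambda>j. engel m (commutator u y) (?z j)" and ?g = "\<lambda>j. engel m (commutator u x) (?z j)"
  have uc: "u \<in> carrier G" using Suc.prems(1) by (rule F_carrier)
  have z: "?z j \<in> carrier G" "y [^] j \<in> carrier G" for j using Suc.prems by simp_all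
  have c: "commutator u v \<in> F (Suc r)" if "v \<in> carrier G" for v
    using F_commutator[of u r v 1] Suc.prems F_one that by simp
  have F: "F (Suc (Suc r + m)) = {\<one>}" using Suc.prems(3) top by simp
  have r: "1 \<le> Suc r" "Suc r + m = s" using Suc.prems(3) by simp_all
  have fF: "?f j \<in> F s" and gF: "?g j \<in> F s" for j
    using engel_F[OF c z(1), of _ m j] Suc.prems r by simp_all
  have "engel (Suc m) u (?z j) = ?f j [^] j \<otimes> ?g j" for j
  proof -
    let ?w = "commutator (commutator u x) (y [^] j)"
    have w: "?w \<in> F (Suc (Suc r))"
      using F_commutator[OF c, of x "y [^] j" 1] Suc.prems F_one by simp
    then have w': "?w \<in> F (Suc r)" using F_Suc by auto
    show ?thesis
      using engel_mult[OF F_mult[OF c[OF z(2)] c[OF Suc.prems(4)]] w' r(1) z(1) F]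
        engel_mult[OF c[OF z(2)] c[OF Suc.prems(4)] r(1) z(1) F] engel_eq_one[OF w z(1) F]
        engel_commutator_power[OF Suc.prems(1,2) z(1) Suc.prems(5) F] uc Suc.prems z(1)
      by (simp add: commutator_mult_right)
  qed
  then have "(diff ^^ Suc m) (\<lambda>j. engel (Suc m) u (?z j)) = (diff ^^ Suc m) (\<lambda>j. ?f j [^] j \<otimes> ?g j)"
    by (simp only:)
  also have "\<dots> = (\<lambda>j. (diff ^^ Suc m) (\<lambda>j. ?f j [^] j) j \<otimes> (diff ^^ Suc m) ?g j)"
    by (rule diff_funpow_mult_top) (use fF gF F_pow in blast)+
  also have "\<dots> = (\<lambda>j. engel (Suc m) u y [^] (fact (Suc m) :: nat))"
  proof -
    have f: "(diff ^^ m) ?f = (\<lambda>j. engel m (commutator u y) y [^] (fact m :: nat))"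
      by (rule Suc.IH[OF c r Suc.prems(4,5)]) fact
    have g: "(diff ^^ m) ?g = (\<lambda>j. engel m (commutator u x) y [^] (fact m :: nat))"
      by (rule Suc.IH[OF c r Suc.prems(4,5)]) fact
    show ?thesis
      unfolding diff_funpow_variable_power_top[of ?f, OF fF]
      using uc Suc.prems by (simp add: f g nat_pow_pow nat_pow_mult algebra_simps del: nat_pow_Suc)
  qed
  finally show ?case .
qed

end

text \<open>This handles the lowest degree, where nilpotency does not remove the Engel term. The
  element is annihilated both by (p-1)!, through differences in j, and by p.\<close>

lemma engel_prime_power:
  fixes p n :: nat
  defines "q \<equiv> p ^ n"
  assumes p: "Factorial_Ring.prime p" and F: "F (Suc (Suc p)) = {\<one>}"
    and exp: "\<And>a. a \<in> F 3 \<Longrightarrow> a [^] q = \<one>"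
    and central: "\<And>x y. \<lbrakk>x \<in> carrier G; y \<in> carrier G\<rbrakk> \<Longrightarrow> y \<otimes> x [^] q = x [^] q \<otimes> y"
    and x: "x \<in> carrier G" and y: "y \<in> carrier G"
  shows "engel p x y [^] (q choose p) = \<one>"
proof -
  let ?C = "q choose p" and ?c = "commutator y x"
  have p2: "2 \<le> p" using p by (rule prime_ge_2_nat)
  then obtain m where m: "p = Suc m" "1 \<le> m" by (cases p) auto
  \<comment> \<open>The innermost commutator is kept at [y, x] instead of [y, x y^j], so that
    \<open>diff_funpow_engel\<close> applies to a fixed first entry. The two differ by an element of
    \<open>F 3\<close>, which the outer commutators annihilate.\<close>
  define f where "f j = engel m ?c (x \<otimes> y [^] j)" for j :: nat
  have c: "?c \<in> F 2" using F_commutator[of y 1 x 1] x y F_one by (simp add: numeral_2_eq_2)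
  have s: "2 + m = Suc p" using m by simp
  have F': "F (Suc (2 + m)) = {\<one>}" using F s by simp
  have z: "x \<otimes> y [^] j \<in> carrier G" for j :: nat using x y by simp
  have fF: "f j \<in> F (Suc p)" for j
    using engel_F[OF c z, of m j] s by (simp add: f_def)
  have key: "inv (commutator b a) [^] q = engel p b a [^] ?C"
    if "a \<in> carrier G" "b \<in> carrier G" for a b
    by (rule commutator_prime_power[OF p, of 1 n, folded q_def])
      (use that F_one F central exp in \<open>simp_all add: numeral_3_eq_3\<close>)
  have "f j [^] ?C = engel p y x [^] ?C" for j
  proof -
    let ?d = "commutator ?c (y [^] j)"
    have cz: "commutator y (x \<otimes> y [^] j) = inv (y [^] j) \<otimes> ?c \<otimes> y [^] j"
      using x y by (rule commutator_mult_power_self)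
    also have "\<dots> = ?c \<otimes> ?d" using x y by (simp add: conj_eq_mult_commutator)
    finally have cz': "commutator y (x \<otimes> y [^] j) = ?c \<otimes> ?d" .
    have d: "?d \<in> F (Suc 2)" using F_commutator[OF c, of "y [^] j" 1] y F_one by simp
    then have d': "?d \<in> F 2" using F_Suc by blast
    have "engel p y (x \<otimes> y [^] j) = f j"
      using engel_mult[OF c d' _ z F'] engel_eq_one[OF d z F'] fF[of j] F_carrier cz'
      by (simp add: m(1) f_def)
    then have "f j [^] ?C = inv (commutator y (x \<otimes> y [^] j)) [^] q"
      using key[OF z y] by simp
    also have "inv (commutator y (x \<otimes> y [^] j)) = inv (y [^] j) \<otimes> inv ?c \<otimes> y [^] j"
      unfolding cz using x y by (simp add: word_simps)
    also have "\<dots> [^] q = inv (y [^] j) \<otimes> engel p y x [^] ?C \<otimes> y [^] j"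
      using x y key[OF x y] by (simp add: conj_pow)
    also have "\<dots> = engel p y x [^] ?C"
    proof -
      have "engel p y x \<in> F (Suc p)" using engel_F[of y 1 x p] x y F_one by simp
      then have "engel p y x [^] ?C \<otimes> y [^] j = y [^] j \<otimes> engel p y x [^] ?C"
        using F_central[OF F F_pow] y by simp
      then show ?thesis using x y by (simp add: m_assoc inv_mult_cancel)
    qed
    finally show ?thesis .
  qed
  then have "(diff ^^ m) (\<lambda>j. f j [^] ?C) = (diff ^^ m) (\<lambda>j. engel p y x [^] ?C)"
    by simp
  also have "\<dots> = (\<lambda>j. \<one>)"
    using diff_funpow_binomial[of "engel p y x [^] ?C" m 0] x y m by simp
  finally have "(diff ^^ m) (\<lambda>j. f j [^] ?C) = (\<lambda>j. \<one>)" .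
  moreover have "(diff ^^ m) f = (\<lambda>j. engel m ?c y [^] (fact m :: nat))"
    using diff_funpow_engel[OF F c _ s x y] by (simp add: f_def[abs_def])
  ultimately have 1: "(engel m ?c y [^] (fact m :: nat)) [^] ?C = \<one>"
    using diff_funpow_power_top[OF F fF, where r = m and c = ?C] by (simp add: fun_eq_iff)
  let ?t = "engel p x y"
  have c': "commutator x y \<in> F 2" using F_commutator[of x 1 y 1] x y F_one by (simp add: numeral_2_eq_2)
  \<comment> \<open>The differences produce the Engel commutator starting from [y, x]; linearity in
    the first entry turns it into the inverse of the one starting from [x, y].\<close>
  have "?c \<otimes> commutator x y = \<one>"
    using l_inv[of "commutator x y"] x y by (simp add: inv_commutator)
  then have "engel m ?c y \<otimes> ?t = engel m \<one> y"
    using engel_mult[OF c c' _ y F'] m by simp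
  also have "\<dots> = \<one>" using engel_eq_one[OF F_1 y F'] .
  finally have t: "engel m ?c y = inv ?t" using x y by (simp add: inv_equality)
  have tc: "?t \<in> carrier G" using x y by simp
  have "inv ((?t [^] ?C) [^] (fact m :: nat)) = \<one>"
    using 1 tc by (simp add: t nat_pow_inv nat_pow_pow mult.commute)
  then have a: "(?t [^] ?C) [^] (fact m :: nat) = \<one>"
    using tc by (metis inv_inv inv_one nat_pow_closed)
  \<comment> \<open>The second annihilating exponent: t^q = 1 by \<open>exp\<close>, and p C(q, p) =
    q C(q-1, p-1).\<close>
  have "?t \<in> F (Suc p)" using engel_F[of x 1 y p] x y F_one by simp
  then have "?t \<in> F 3" using F_antimono[of 3 "Suc p"] p2 by auto
  then have "?t [^] q = \<one>" by (rule exp)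
  moreover have "q dvd ?C * p"
    using times_binomial_minus1_eq[of p q] p2 by (simp add: mult.commute)
  ultimately have b: "(?t [^] ?C) [^] p = \<one>"
    using tc by (metis dvdE nat_pow_one nat_pow_pow)
  have "coprime p (fact m :: nat)"
    using p m by (intro prime_imp_coprime) (simp_all add: prime_dvd_fact_iff)
  then have "ord (?t [^] ?C) = 1"
    using a b tc pow_eq_id[of "?t [^] ?C"] by (metis coprime_def nat_dvd_1_iff_1 nat_pow_closed)
  then show ?thesis using tc pow_ord_eq_1[of "?t [^] ?C"] by simp
qed

end

section \<open>The exponent of the commutator subgroup\<close>

context group begin

text \<open>
  With $\gamma_k(G)$ equal to \<open>lower_central G (k - 1)\<close>, truncated subtraction gives
  $\gamma_0(G) = \gamma_1(G) = G$, so that $m \mapsto x^m$ satisfies \<open>poly_seq 0\<close>.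
\<close>
lemma group_filtration_lower_central: "group_filtration G (\<lambda>i. lower_central G (i - 1))"
proof (intro group_filtration.intro group_filtration_axioms.intro)
  show "lower_central G (Suc i - 1) \<subseteq> lower_central G (i - 1)" for i
    using lower_central_Suc_subset by (cases i) simp_all
  show "commutator a b \<in> lower_central G (i + j - 1)"
    if a: "a \<in> lower_central G (i - 1)" and b: "b \<in> lower_central G (j - 1)" for a b i j
  proof -
    have c: "a \<in> carrier G" "b \<in> carrier G"
      using a b subgroup.mem_carrier[OF lower_central_subgroup] by auto
    \<comment> \<open>If one index is 0, the target is the term of the other entry or a larger one,
      and normality suffices.\<close>
    consider "i = 0" | "j = 0" | "i \<noteq> 0" "j \<noteq> 0" by auto
    then show ?thesis
    proof cases
      case 3
      then have "Suc (i - 1 + (j - 1)) = i + j - 1" by simp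
      then show ?thesis using commutator_lower_central[OF a b] by (simp only:)
    qed (use commutator_in_normal[OF lower_central_normal] a b c in simp_all)
  qed
qed (simp_all add: lower_central_normal group_axioms)

lemma lower_central_prime_power:
  fixes p n :: nat
  defines "q \<equiv> p ^ n"
  assumes p: "Factorial_Ring.prime p" and nilp: "lower_central G (Suc p) = {\<one>}"
    and central: "\<And>x y. \<lbrakk>x \<in> carrier G; y \<in> carrier G\<rbrakk> \<Longrightarrow> y \<otimes> x [^] q = x [^] q \<otimes> y"
    and a: "a \<in> lower_central G 1"
  shows "a [^] q = \<one>"
proof -
  interpret F: group_filtration G "\<lambda>i. lower_central G (i - 1)"
    by (rule group_filtration_lower_central)
  have triv: "lower_central G k = {\<one>}" if "Suc p \<le> k" for k
    using F.F_antimono[of "Suc (Suc p)" "Suc k"] F.F_1[of "Suc k"] that nilp by auto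
  have "0 \<le> p" by simp
  \<comment> \<open>The induction descends from k = p, where the term is trivial, to k = 0, which is
    gamma_2. Step k works in degree \<open>Suc k\<close> of the filtration.\<close>
  then have "\<forall>a\<in>lower_central G (Suc 0). a [^] q = \<one>"
  proof (induction rule: inc_induct)
    case base
    then show ?case by (simp add: nilp)
  next
    case (step k)
    have exp: "a [^] q = \<one>" if "a \<in> lower_central G (Suc k + 2 - 1)" for a
      using step that by simp
    have F: "lower_central G (Suc (Suc k + p) - 1) = {\<one>}" by (rule triv) simp
    have k: "1 \<le> Suc k" by simp
    show ?case
    proof
      fix a assume "a \<in> lower_central G (Suc k)"
      then show "a [^] q = \<one>"
      proof (induction rule: lower_central_Suc_induct)
        case (commutator h x)
        have h: "h \<in> carrier G" using commutator(1) by (rule F.F_carrier[of _ "Suc k", simplified])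
        have "engel p h x [^] (q choose p) = \<one>"
        \<comment> \<open>The Engel commutator lies in \<open>lower_central G (k + p)\<close>, which
          is trivial as soon as k is positive.\<close>
        proof (cases k)
          case 0
          have "lower_central G (Suc (Suc p) - 1) = {\<one>}" using nilp by simp
          moreover have "a [^] q = \<one>" if "a \<in> lower_central G (3 - 1)" for a
            using exp[of a] that 0 by (simp add: numeral_2_eq_2)
          ultimately show ?thesis
            unfolding q_def
            by (rule F.engel_prime_power[OF p]) (use central h commutator(2) in \<open>simp_all add: q_def\<close>)
        next
          case (Suc k')
          then have "engel p h x = \<one>"
            using F.engel_F[of h "Suc k" x p] commutator triv[of "k + p"] by simp
          then show ?thesis by simp
        qed
        moreover have "inv (commutator h x) [^] q = engel p h x [^] (q choose p)"
          unfolding q_def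
          by (rule F.commutator_prime_power[OF p k F])
            (use exp central commutator h in \<open>simp_all add: q_def\<close>)
        ultimately have "inv (commutator h x [^] q) = \<one>"
          using h commutator(2) by (simp add: nat_pow_inv)
        then show ?case using h commutator(2) by (metis commutator_closed inv_inv inv_one nat_pow_closed)
      next
        case (inv a)
        then show ?case using F.F_carrier[of a "Suc (Suc k)"] by (simp add: nat_pow_inv)
      next
        case (mult a b)
        have "(a \<otimes> b) [^] q = a [^] q \<otimes> b [^] q"
          unfolding q_def
          by (rule F.mult_prime_power[OF p k F]) (use exp mult in \<open>simp_all add: q_def\<close>)
        then show ?case using mult by simp
      qed simp
    qed
  qed
  then show ?thesis using a by simp
qed

section \<open>From the exponent of the central quotient to the theorem\<close>

lemma k_central_pow_mem_center:
  assumes "k_central k G" "0 < k" "x \<in> carrier G"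
  shows "x [^] k \<in> center G"
proof -
  interpret Z: normal "center G" G by (rule center_normal)
  interpret Q: group "G Mod center G" by (rule Z.factorgroup_is_group)
  interpret h: group_hom G "G Mod center G" "\<lambda>a. center G #> a"
    by unfold_locales (rule Z.r_coset_hom_Mod)
  have "(center G #> x) [^]\<^bsub>G Mod center G\<^esub> k = \<one>\<^bsub>G Mod center G\<^esub>"
    using assms Q.group_exponent_dvd_iff[of k] h.hom_closed[of x] by (simp add: k_central_def)
  then have "center G #> x [^] k = center G"
    using assms(3) h.hom_nat_pow by simp
  then show ?thesis
    using rcos_self[OF _ Z.subgroup_axioms, of "x [^] k"] assms(3) by simp
qed

end

theorem theorem3p9:
  fixes G :: "('a, 'b) monoid_scheme" and p n :: nat
  assumes "Factorial_Ring.prime p" and "odd p"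
    and "n \<ge> 1"
    and "p_group p G"
    and "nilpotent_group G" and "nilpotency_class G = p + 1"
    and "k_central (p ^ n) G"
  shows "group_exponent (gamma2 G) dvd p ^ n"
proof -
  interpret group G using assms(5) by (simp add: nilpotent_group_def)
  have q: "0 < p ^ n" using assms(1) by (simp add: prime_gt_0_nat)
  \<comment> \<open>The least index is attained because nilpotency provides some index.\<close>
  have "lower_central G (nilpotency_class G) = {\<one>\<^bsub>G\<^esub>}"
    using assms(5) unfolding nilpotent_group_def nilpotency_class_def by (elim conjE) (rule LeastI_ex)
  then have nilp: "lower_central G (Suc p) = {\<one>\<^bsub>G\<^esub>}" using assms(6) by simp
  have central: "y \<otimes>\<^bsub>G\<^esub> x [^]\<^bsub>G\<^esub> p ^ n = x [^]\<^bsub>G\<^esub> p ^ n \<otimes>\<^bsub>G\<^esub> y"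
    if "x \<in> carrier G" "y \<in> carrier G" for x y
    using k_central_pow_mem_center[OF assms(7) q that(1)] that(2) by (simp add: center_def)
  have "x [^]\<^bsub>G\<^esub> p ^ n = \<one>\<^bsub>G\<^esub>" if "x \<in> derived G (carrier G)" for x
    using lower_central_prime_power[OF assms(1) nilp central] that lower_central_1[of G] by simp
  moreover have "group (gamma2 G)"
    by (intro subgroup_imp_group derived_is_subgroup) simp
  \<comment> \<open>Powers in \<open>gamma2 G\<close> and in G agree because
    \<open>nat_pow_def\<close> does not refer to the carrier.\<close>
  ultimately show ?thesis
    using group.group_exponent_dvd_iff[of "gamma2 G", OF _ q] by (simp add: nat_pow_def)
qed

end
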